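(* If a $d$-dimensional point configuration $A\subset\mathbb{R}^d$ admits a weak Cayley decomposition of length $m$, then $\deg(A)\le d+1-m$.
   Context: A $d$-dimensional point configuration is a finite family $A$ of points whose affine span is $\mathbb{R}^d$; repeated points are allowed (treated as distinct labelled elements). A non-empty subset $S\subseteq A$ is an interior face of $A$ if $\mathrm{conv}(S)$ is not contained in the boundary of $\mathrm{conv}(A)$. The degree $\deg(A)$ is the maximal codimension $d-\dim\mathrm{conv}(S)$ of an interior face $S$ of $A$. A weak Cayley decomposition of $A$ of length $m\ge 1$ is a partition $A=A_0\uplus A_1\uplus\cdots\uplus A_m$ with $A_1,\dots,A_m$ non-empty ($A_0$ may be empty) such that for every $1\le i\le m$, $A\setminus A_i$ is exactly the set of points of $A$ lying in some proper face of $\mathrm{conv}(A)$ (a face different from $\mathrm{conv}(A)$; the empty face is allowed). *)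

theory Defs
  imports "HOL-Analysis.Analysis"
begin

text \<open>A point configuration is a family \<open>p\<close> of points over a finite set \<open>I\<close> of labels, so that
  repeated points stay distinct elements. Subsets of the configuration are subsets of \<open>I\<close>.

  The space \<open>\<real>\<^sup>d\<close> is the affine span of the configuration, a \<open>d\<close>-dimensional affine subspace of
  a Euclidean type; a Euclidean type itself always has positive dimension, and \<open>d = 0\<close> would
  otherwise be lost. Boundaries are accordingly taken in the affine span (\<open>rel_frontier\<close>). The
  first two lemmas below treat the case that the affine span is the whole type.\<close>

definition point_configuration :: "nat \<Rightarrow> 'i set \<Rightarrow> ('i \<Rightarrow> 'a::euclidean_space) \<Rightarrow> bool" where
  "point_configuration d I p \<longleftrightarrow> finite I \<and> aff_dim (affine hull (p ` I)) = int d"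

definition interior_face :: "'i set \<Rightarrow> ('i \<Rightarrow> 'a::euclidean_space) \<Rightarrow> 'i set \<Rightarrow> bool" where
  "interior_face I p S \<longleftrightarrow>
     S \<subseteq> I \<and> S \<noteq> {} \<and> \<not> convex hull (p ` S) \<subseteq> rel_frontier (convex hull (p ` I))"

definition config_degree :: "'i set \<Rightarrow> ('i \<Rightarrow> 'a::euclidean_space) \<Rightarrow> int" where
  "config_degree I p =
     Max ((\<lambda>S. aff_dim (affine hull (p ` I)) - aff_dim (convex hull (p ` S)))
            ` {S. interior_face I p S})"

text \<open>\<open>P 0\<close> is the possibly empty part \<open>A\<^sub>0\<close>. The relation \<open>face_of\<close> admits the empty face.\<close>

definition weak_Cayley_decomposition ::
    "'i set \<Rightarrow> ('i \<Rightarrow> 'a::euclidean_space) \<Rightarrow> nat \<Rightarrow> (nat \<Rightarrow> 'i set) \<Rightarrow> bool" where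
  "weak_Cayley_decomposition I p m P \<longleftrightarrow>
     1 \<le> m \<and> (\<Union>i\<in>{0..m}. P i) = I \<and> disjoint_family_on P {0..m} \<and>
     (\<forall>i\<in>{1..m}. P i \<noteq> {} \<and>
        (\<exists>F. F face_of (convex hull (p ` I)) \<and> F \<noteq> convex hull (p ` I) \<and>
             I - P i = {j \<in> I. p j \<in> F}))"

lemma point_configuration_full:
  fixes p :: "'i \<Rightarrow> 'a::euclidean_space"
  shows "point_configuration (DIM('a)) I p \<longleftrightarrow> finite I \<and> affine hull (p ` I) = UNIV"
  by (simp add: point_configuration_def aff_dim_eq_full)

lemma rel_frontier_full:
  fixes p :: "'i \<Rightarrow> 'a::euclidean_space"
  assumes "affine hull (p ` I) = UNIV"
  shows "rel_frontier (convex hull (p ` I)) = frontier (convex hull (p ` I))"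
  by (rule rel_frontier_frontier) (simp add: assms)

text \<open>The maximum in \<^const>\<open>config_degree\<close> ranges over a finite non-empty set.\<close>

lemma finite_interior_faces: "finite I \<Longrightarrow> finite {S. interior_face I p S}"
  by (rule finite_subset[of _ "Pow I"]) (auto simp: interior_face_def)

lemma interior_face_self:
  assumes "point_configuration d I p"
  shows "interior_face I p I"
proof -
  have ne: "I \<noteq> {}"
    using assms by (auto simp: point_configuration_def)
  then have "rel_interior (convex hull (p ` I)) \<noteq> {}"
    by (simp add: rel_interior_eq_empty)
  then show ?thesis
    using ne rel_interior_subset[of "convex hull (p ` I)"]
    by (auto simp: interior_face_def rel_frontier_def)
qed

end

theory Submission
  imports Defs
begin

text \<open>A set of labels avoiding some \<open>A\<^sub>i\<close> with \<open>i \<ge> 1\<close> lies in a proper face, so an interior face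
  contains a point of each of \<open>A\<^sub>1, \<dots>, A\<^sub>m\<close>. Such points are affinely independent: the affine hull
  of all but the \<open>i\<close>-th meets \<open>conv A\<close> within the \<open>i\<close>-th proper face, which misses the \<open>i\<close>-th point.
  So every interior face has dimension at least \<open>m - 1\<close>.\<close>

lemma affine_independent_faces:
  fixes s :: "'b \<Rightarrow> 'a::euclidean_space"
  assumes "convex C" and "\<And>i. i \<in> K \<Longrightarrow> s i \<in> C" and "\<And>i. i \<in> K \<Longrightarrow> F i face_of C"
    and notin: "\<And>i. i \<in> K \<Longrightarrow> s i \<notin> F i"
    and mem: "\<And>i j. i \<in> K \<Longrightarrow> j \<in> K \<Longrightarrow> i \<noteq> j \<Longrightarrow> s j \<in> F i"
  shows "inj_on s K" and "\<not> affine_dependent (s ` K)"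
proof -
  \<comment> \<open>Affine independence of the image set ignores repeated values, so injectivity is
    proved separately; it guarantees that the image has as many points as \<open>K\<close> has
    elements.\<close>
  show "inj_on s K"
    using notin mem by (metis inj_onI)
  show "\<not> affine_dependent (s ` K)"
  proof
    assume "affine_dependent (s ` K)"
    then obtain i where i: "i \<in> K" and hull: "s i \<in> affine hull (s ` K - {s i})"
      by (auto simp: affine_dependent_def)
    have "s ` K - {s i} \<subseteq> F i"
      using i mem by auto
    then have "s i \<in> affine hull (F i) \<inter> C"
      using hull hull_mono assms(2) i by blast
    also have "\<dots> = F i"
      using face_of_imp_eq_affine_Int assms(1,3) i by metis
    finally show False
      using notin i by blast
  qed
qed

text \<open>A convex face containing all points of \<open>S\<close> contains their hull, and a
  proper face lies in the relative frontier.\<close>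

lemma interior_face_notin_face:
  assumes "interior_face I p S" and "F face_of convex hull (p ` I)" and "F \<noteq> convex hull (p ` I)"
  shows "\<exists>j\<in>S. p j \<notin> F"
proof (rule ccontr)
  assume "\<not> ?thesis"
  then have "convex hull (p ` S) \<subseteq> F"
    using face_of_imp_convex[OF assms(2)] by (intro hull_minimal) auto
  then show False
    using assms face_of_subset_rel_frontier by (fastforce simp: interior_face_def)
qed

lemma aff_dim_interior_face_ge:
  fixes p :: "'i \<Rightarrow> 'a::euclidean_space"
  assumes W: "weak_Cayley_decomposition I p m P" and S: "interior_face I p S"
  shows "int m - 1 \<le> aff_dim (convex hull (p ` S))"
proof -
  let ?C = "convex hull (p ` I)"
  have sub: "S \<subseteq> I"
    using S by (simp add: interior_face_def)
  obtain F where F: "F i face_of ?C" "F i \<noteq> ?C" "I - P i = {j \<in> I. p j \<in> F i}"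
    if "i \<in> {1..m}" for i
    using W unfolding weak_Cayley_decomposition_def by metis
  have "\<exists>j\<in>S. p j \<notin> F i" if "i \<in> {1..m}" for i
    using interior_face_notin_face[OF S] F(1,2)[OF that] by blast
  then obtain s where s: "s i \<in> S" "p (s i) \<notin> F i" if "i \<in> {1..m}" for i
    by metis
  have sP: "s i \<in> P i" if "i \<in> {1..m}" for i
    using s[OF that] F(3)[OF that] sub by blast
  have disj: "P i \<inter> P j = {}" if "i \<in> {1..m}" "j \<in> {1..m}" "i \<noteq> j" for i j
    using W that by (auto simp: weak_Cayley_decomposition_def disjoint_family_on_def)
  \<comment> \<open>Disjointness keeps \<open>s j\<close> out of \<open>P i\<close>, and the points
    labelled by \<open>I - P i\<close> are those in \<open>F i\<close>.\<close>
  have mem: "p (s j) \<in> F i" if "i \<in> {1..m}" "j \<in> {1..m}" "i \<noteq> j" for i j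
    using disj[OF that] sP[OF that(2)] s(1)[OF that(2)] F(3)[OF that(1)] sub by blast
  have inC: "p (s i) \<in> ?C" if "i \<in> {1..m}" for i
    using s(1)[OF that] sub by (auto intro: hull_inc)
  note ind = affine_independent_faces[where s = "\<lambda>i. p (s i)" and K = "{1..m}" and F = F,
      OF convex_convex_hull inC F(1) s(2) mem]
  \<comment> \<open>By injectivity these are \<open>m\<close> affinely independent points, so they
    span dimension \<open>m - 1\<close>.\<close>
  have "int m - 1 = aff_dim ((\<lambda>i. p (s i)) ` {1..m})"
    using ind(1) aff_dim_affine_independent[OF ind(2)] by (simp add: card_image)
  also have "\<dots> \<le> aff_dim (p ` S)"
    using s(1) by (intro aff_dim_subset) auto
  finally show ?thesis
    by (simp add: aff_dim_convex_hull)
qed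

theorem proposition2p6:
  fixes I :: "'i set" and p :: "'i \<Rightarrow> 'a::euclidean_space" and d m :: nat
  assumes "point_configuration d I p"
    and "\<exists>P. weak_Cayley_decomposition I p m P"
  shows "config_degree I p \<le> int d + 1 - int m"
proof -
  obtain P where W: "weak_Cayley_decomposition I p m P"
    using assms(2) by blast
  have "finite I" and d: "aff_dim (affine hull (p ` I)) = int d"
    using assms(1) by (auto simp: point_configuration_def)
  then have "finite {S. interior_face I p S}" "{S. interior_face I p S} \<noteq> {}"
    using finite_interior_faces interior_face_self[OF assms(1)] by auto
  \<comment> \<open>Every interior face has codimension at most \<open>d - (m - 1)\<close>, hence so
    does the maximum.\<close>
  then show ?thesis
    unfolding config_degree_def d
    using aff_dim_interior_face_ge[OF W] by (subst Max_le_iff) fastforce+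
qed

end
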